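(* Let $\Gamma=\langle\tau\rangle\subset\mathrm{Aut}(\mathrm{Spin}_8)$ be the group generated by the triality automorphism $\tau$, and consider $X=\mathbb{S}^7\times\mathbb{S}^7=\mathrm{Spin}_8/G_2$ with base point $o=(1,1)$ and the associated groups $\Gamma_x$ ($x\in X$). Then every maximal antipodal set of $X$ (with respect to $\Gamma$) containing $o$ equals $$P=\{(1,1),\,(s,\overline s),\,(\overline s,s)\},\qquad s=\tfrac12\left(-1+\sqrt3\,v\right),$$ for some $v\in\mathbb{S}^6\subset\mathrm{Im}\,\mathbb{O}$, where $v$ may be arbitrary (that is, for every $v\in\mathbb{S}^6$ the set $P$ so defined is a maximal antipodal set containing $o$). Moreover, the outer involution $\sigma$, acting on $X$, fixes $(1,1)$ and interchanges the other two elements of $P$.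
   Context: $\mathbb{O}\cong\mathbb{R}^8$ denotes the octonions with the standard Euclidean norm, $x\mapsto\overline x$ is octonionic conjugation, $\kappa=\mathrm{diag}(1,-1,\dots,-1)$ is its matrix, $\mathrm{Im}\,\mathbb{O}\cong\mathbb{R}^7$ is the orthogonal complement of $\mathbb{R}\cdot 1$, $\mathbb{S}^7$ is the unit sphere of $\mathbb{O}$ and $\mathbb{S}^6$ the unit sphere of $\mathrm{Im}\,\mathbb{O}$. For $D\in SO_8$ put $\tilde D=\kappa D\kappa\in SO_8$. $\mathrm{Spin}_8$ is realized as the group of triples $(A,B,C)\in(SO_8)^3$ satisfying $B(x\cdot y)=(Cx)\cdot(Ay)$ for all $x,y\in\mathbb{O}$. The triality automorphism, which has order 3, is $\tau(A,B,C)=(\tilde B,\tilde C,A)$, and the outer involution is $\sigma(A,B,C)=(B,A,\tilde C)$; both are automorphisms of $\mathrm{Spin}_8$. $G_2=\mathrm{Aut}(\mathbb{O})$ is embedded in $\mathrm{Spin}_8$ as $\{(A,A,A):A\in\mathrm{Aut}(\mathbb{O})\}$; it is fixed pointwise by $\tau$ and $\sigma$. $\mathrm{Spin}_8$ acts on $X=\mathbb{S}^7\times\mathbb{S}^7$ by $(A,B,C)\cdot(x,y)=(Ax,By)$; this action is transitive with isotropy group $G_2$ at $o=(1,1)$, so $X\cong\mathrm{Spin}_8/G_2$ via $gG_2\mapsto g\cdot o$. Every automorphism $\gamma$ in the group generated by $\tau,\sigma$ acts on $X$ by $\gamma(g\cdot o)=\gamma(g)\cdot o$ for $g\in \mathrm{Spin}_8$;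 explicitly $\tau(x,y)=(\overline y,\,x\overline y)$ and $\sigma(x,y)=(y,x)$. For $x=g\cdot o\in X$ with $g\in\mathrm{Spin}_8$, set $\Gamma_x=g\,\Gamma\,g^{-1}$, a group of transformations of $X$; this does not depend on the choice of $g$, and $\Gamma_o=\Gamma$. For a group $\Lambda$ acting on $X$, $\mathrm{Fix}(\Lambda)=\{x\in X:\lambda(x)=x\ \forall\lambda\in\Lambda\}$. An antipodal set in $X$ is a subset $P\subset X$ such that $P\subset\mathrm{Fix}(\Gamma_p)$ for all $p\in P$; maximal means maximal with respect to inclusion. *)

theory Defs
  imports "HOL-Analysis.Analysis" "HOL-Algebra.Bij" "HOL-Algebra.Generated_Groups"
begin

section \<open>The octonions\<close>

text \<open>
  An octonion is a vector in \<open>\<real>\<^sup>8\<close>, with the norm and inner product of the library.  The index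
  type \<open>8\<close> has the elements \<open>0, \<dots>, 7\<close> (where \<open>8 = 0\<close>); index \<open>0\<close> is the real coordinate.
  The library's \<open>1\<close> and \<open>*\<close> on vectors are the all-ones vector and the componentwise product, so
  the octonion unit and product have names of their own.
\<close>

type_synonym octonion = "real ^ 8"

definition oct_one :: octonion where
  "oct_one = axis 0 1"

text \<open>
  The imaginary units satisfy \<open>e\<^sub>i e\<^sub>j = e\<^sub>k = - e\<^sub>j e\<^sub>i\<close> for \<open>(i, j, k)\<close> any cyclic permutation of
  \<open>(1,2,4)\<close>, \<open>(2,3,5)\<close>, \<open>(3,4,6)\<close>, \<open>(4,5,7)\<close>, \<open>(5,6,1)\<close>, \<open>(6,7,2)\<close>, \<open>(7,1,3)\<close>, and \<open>e\<^sub>i e\<^sub>i = -1\<close>.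
\<close>

definition oct_mult :: "octonion \<Rightarrow> octonion \<Rightarrow> octonion"  (infixl "\<odot>" 70) where
  "x \<odot> y = (\<chi> k.
     if k = 0 then x $ 0 * y $ 0 - x $ 1 * y $ 1 - x $ 2 * y $ 2 - x $ 3 * y $ 3 - x $ 4 * y $ 4 - x $ 5 * y $ 5 - x $ 6 * y $ 6 - x $ 7 * y $ 7
     else if k = 1 then x $ 0 * y $ 1 + x $ 1 * y $ 0 + (x $ 2 * y $ 4 - x $ 4 * y $ 2) + (x $ 5 * y $ 6 - x $ 6 * y $ 5) + (x $ 3 * y $ 7 - x $ 7 * y $ 3)
     else if k = 2 then x $ 0 * y $ 2 + x $ 2 * y $ 0 + (x $ 4 * y $ 1 - x $ 1 * y $ 4) + (x $ 3 * y $ 5 - x $ 5 * y $ 3) + (x $ 6 * y $ 7 - x $ 7 * y $ 6)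
     else if k = 3 then x $ 0 * y $ 3 + x $ 3 * y $ 0 + (x $ 5 * y $ 2 - x $ 2 * y $ 5) + (x $ 4 * y $ 6 - x $ 6 * y $ 4) + (x $ 7 * y $ 1 - x $ 1 * y $ 7)
     else if k = 4 then x $ 0 * y $ 4 + x $ 4 * y $ 0 + (x $ 1 * y $ 2 - x $ 2 * y $ 1) + (x $ 6 * y $ 3 - x $ 3 * y $ 6) + (x $ 5 * y $ 7 - x $ 7 * y $ 5)
     else if k = 5 then x $ 0 * y $ 5 + x $ 5 * y $ 0 + (x $ 2 * y $ 3 - x $ 3 * y $ 2) + (x $ 7 * y $ 4 - x $ 4 * y $ 7) + (x $ 6 * y $ 1 - x $ 1 * y $ 6)
     else if k = 6 then x $ 0 * y $ 6 + x $ 6 * y $ 0 + (x $ 3 * y $ 4 - x $ 4 * y $ 3) + (x $ 1 * y $ 5 - x $ 5 * y $ 1) + (x $ 7 * y $ 2 - x $ 2 * y $ 7)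
     else x $ 0 * y $ 7 + x $ 7 * y $ 0 + (x $ 4 * y $ 5 - x $ 5 * y $ 4) + (x $ 2 * y $ 6 - x $ 6 * y $ 2) + (x $ 1 * y $ 3 - x $ 3 * y $ 1))"

lemma UNIV_index8: "(UNIV :: 8 set) = {0, 1, 2, 3, 4, 5, 6, 7}"
proof (rule sym, rule card_subset_eq)
  show "card {0, 1, 2, 3, 4, 5, 6, 7 :: 8} = card (UNIV :: 8 set)"
    by simp
qed simp_all

lemma all_index8: "(\<forall>k::8. P k) \<longleftrightarrow> P 0 \<and> P 1 \<and> P 2 \<and> P 3 \<and> P 4 \<and> P 5 \<and> P 6 \<and> P 7"
  using UNIV_index8 by (metis UNIV_I empty_iff insert_iff)

lemma sum_index8: "sum f (UNIV :: 8 set) = f 0 + f 1 + f 2 + f 3 + f 4 + f 5 + f 6 + f 7"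
  unfolding UNIV_index8 by (simp add: add.assoc)

text \<open>
  By Hurwitz's theorem the following facts determine the bilinear product up to isomorphism.
\<close>

lemma oct_one_mult [simp]: "oct_one \<odot> x = x"
  and oct_mult_one [simp]: "x \<odot> oct_one = x"
  by (simp_all add: vec_eq_iff oct_mult_def oct_one_def axis_def all_index8)

lemma norm_oct_mult: "norm (x \<odot> y) = norm x * norm y"
proof -
  have "(norm (x \<odot> y))\<^sup>2 = (norm x * norm y)\<^sup>2"
    unfolding power_mult_distrib power2_norm_eq_inner inner_vec_def sum_index8
    by (simp add: oct_mult_def) algebra
  then show ?thesis
    by (simp add: power2_eq_iff_nonneg)
qed

text \<open>The matrix of octonionic conjugation, \<open>diag(1, -1, \<dots>, -1)\<close>.\<close>

definition kappa :: "real ^ 8 ^ 8" where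
  "kappa = (\<chi> i j. if i = j then (if i = 0 then 1 else - 1) else 0)"

definition oct_cnj :: "octonion \<Rightarrow> octonion" where
  "oct_cnj x = kappa *v x"

definition oct_Im :: "octonion set" where
  "oct_Im = (span {oct_one})\<^sup>\<bottom>"

definition sphere7 :: "octonion set" where
  "sphere7 = sphere 0 1"

definition sphere6 :: "octonion set" where
  "sphere6 = {v \<in> oct_Im. norm v = 1}"


section \<open>The group \<open>Spin\<^sub>8\<close> and its automorphisms\<close>

definition kappa_conj :: "real ^ 8 ^ 8 \<Rightarrow> real ^ 8 ^ 8" where
  "kappa_conj D = kappa ** D ** kappa"

type_synonym mat_triple = "(real ^ 8 ^ 8) \<times> (real ^ 8 ^ 8) \<times> (real ^ 8 ^ 8)"

definition Spin8 :: "mat_triple monoid" where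
  "Spin8 =
    \<lparr>carrier = {(A, B, C). rotation_matrix A \<and> rotation_matrix B \<and> rotation_matrix C \<and>
                 (\<forall>x y. B *v (x \<odot> y) = (C *v x) \<odot> (A *v y))},
     mult = (\<lambda>(A, B, C) (A', B', C'). (A ** A', B ** B', C ** C')),
     one = (mat 1, mat 1, mat 1)\<rparr>"

text \<open>
  The elements of the library's \<^const>\<open>AutoGroup\<close> are extensional functions, hence the restrictions.
\<close>

definition triality :: "mat_triple \<Rightarrow> mat_triple" where
  "triality = restrict (\<lambda>(A, B, C). (kappa_conj B, kappa_conj C, A)) (carrier Spin8)"

definition outer_invol :: "mat_triple \<Rightarrow> mat_triple" where
  "outer_invol = restrict (\<lambda>(A, B, C). (B, A, kappa_conj C)) (carrier Spin8)"

definition triality_group :: "(mat_triple \<Rightarrow> mat_triple) set" where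
  "triality_group = generate (AutoGroup Spin8) {triality}"


section \<open>The space \<open>\<S>\<^sup>7 \<times> \<S>\<^sup>7\<close> and its antipodal sets\<close>

definition S7xS7 :: "(octonion \<times> octonion) set" where
  "S7xS7 = sphere7 \<times> sphere7"

definition base_pt :: "octonion \<times> octonion" where
  "base_pt = (oct_one, oct_one)"

fun spin_act :: "mat_triple \<Rightarrow> octonion \<times> octonion \<Rightarrow> octonion \<times> octonion" where
  "spin_act (A, B, C) (x, y) = (A *v x, B *v y)"

text \<open>
  The transformation \<open>g\<cdot>o \<mapsto> \<gamma>(g)\<cdot>o\<close> of \<^const>\<open>S7xS7\<close>, for an automorphism \<open>\<gamma>\<close>.  For \<open>\<gamma>\<close> in the group generated
  by \<^const>\<open>triality\<close> and \<^const>\<open>outer_invol\<close> the image does not depend on \<open>g\<close>, because \<open>\<gamma>\<close> fixes the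
  isotropy group \<open>G\<^sub>2\<close> of \<open>o\<close> pointwise.  Transformations of \<^const>\<open>S7xS7\<close> are taken to be undefined
  outside \<^const>\<open>S7xS7\<close>, so that equality of transformations is equality on \<^const>\<open>S7xS7\<close>.
\<close>

definition aut_act ::
  "(mat_triple \<Rightarrow> mat_triple) \<Rightarrow> octonion \<times> octonion \<Rightarrow> octonion \<times> octonion" where
  "aut_act \<gamma> = (\<lambda>p\<in>S7xS7. THE q. \<exists>g\<in>carrier Spin8. spin_act g base_pt = p \<and> q = spin_act (\<gamma> g) base_pt)"

definition conj_transf ::
  "mat_triple \<Rightarrow> (octonion \<times> octonion \<Rightarrow> octonion \<times> octonion) \<Rightarrow>
   octonion \<times> octonion \<Rightarrow> octonion \<times> octonion" where
  "conj_transf g f = (\<lambda>p\<in>S7xS7. spin_act g (f (spin_act (inv\<^bsub>Spin8\<^esub> g) p)))"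

text \<open>
  The group \<open>\<Gamma>\<^sub>x = g \<Gamma> g\<^sup>-\<^sup>1\<close> for \<open>x = g\<cdot>o\<close>, independent of the choice of \<open>g\<close>.
\<close>

definition Gamma_at ::
  "(mat_triple \<Rightarrow> mat_triple) set \<Rightarrow> octonion \<times> octonion \<Rightarrow>
   (octonion \<times> octonion \<Rightarrow> octonion \<times> octonion) set" where
  "Gamma_at \<Gamma> x =
    (THE S. \<exists>g\<in>carrier Spin8. spin_act g base_pt = x \<and> S = (\<lambda>\<gamma>. conj_transf g (aut_act \<gamma>)) ` \<Gamma>)"

definition Fix :: "(octonion \<times> octonion \<Rightarrow> octonion \<times> octonion) set \<Rightarrow> (octonion \<times> octonion) set" where
  "Fix \<Lambda> = {x \<in> S7xS7. \<forall>f\<in>\<Lambda>. f x = x}"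

definition antipodal_set ::
  "(mat_triple \<Rightarrow> mat_triple) set \<Rightarrow> (octonion \<times> octonion) set \<Rightarrow> bool" where
  "antipodal_set \<Gamma> P \<longleftrightarrow> P \<subseteq> S7xS7 \<and> (\<forall>p\<in>P. P \<subseteq> Fix (Gamma_at \<Gamma> p))"

definition maximal_antipodal_set ::
  "(mat_triple \<Rightarrow> mat_triple) set \<Rightarrow> (octonion \<times> octonion) set \<Rightarrow> bool" where
  "maximal_antipodal_set \<Gamma> P \<longleftrightarrow>
    antipodal_set \<Gamma> P \<and> (\<forall>Q. antipodal_set \<Gamma> Q \<and> P \<subseteq> Q \<longrightarrow> Q = P)"

definition cube_root :: "octonion \<Rightarrow> octonion" where
  "cube_root v = (1 / 2) *\<^sub>R (- oct_one + sqrt 3 *\<^sub>R v)"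

definition cube_root_set :: "octonion \<Rightarrow> (octonion \<times> octonion) set" where
  "cube_root_set v =
    {(oct_one, oct_one),
     (cube_root v, oct_cnj (cube_root v)),
     (oct_cnj (cube_root v), cube_root v)}"

end

theory Submission
  imports Defs
begin

text \<open>
  Triality transforms \<open>\<S>\<^sup>7 \<times> \<S>\<^sup>7\<close> by \<open>\<tau>(x, y) = (y\<^sup>*, x y\<^sup>*)\<close>, where the star is conjugation, and
  \<open>\<tau>(g\<cdot>p) = \<tau>(g)\<cdot>\<tau>(p)\<close> for \<open>g\<close> in \<open>Spin\<^sub>8\<close> (lemma \<open>triality_transf_equivariant\<close>).  So the group at
  \<open>g\<cdot>o\<close> consists of the conjugates of the powers of \<open>\<tau>\<close> by \<open>g\<close>, and it fixes \<open>g\<cdot>q\<close> exactly if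
  \<open>\<tau>\<close> fixes \<open>q\<close> (lemma \<open>Fix_Gamma_at_iff\<close>).

  The fixed points of \<open>\<tau>\<close> are the pairs \<open>(x, x\<^sup>*)\<close> with \<open>x x = x\<^sup>*\<close>.  A unit octonion satisfies
  \<open>x x = 2 Re(x) x - 1\<close> and \<open>x\<^sup>* = 2 Re(x) - x\<close>, which turns the equation into
  \<open>(2 Re(x) + 1) (x - 1) = 0\<close>.  So \<open>x = 1\<close> or \<open>Re(x) = -1/2\<close>, and in the second case
  \<open>x = (-1 + \<surd>3 v)/2\<close> for an imaginary unit \<open>v\<close>: all points antipodal to \<open>o\<close> come from cube roots
  of unity.

  Let \<open>s\<close> and \<open>t\<close> be two cube roots of unity, with imaginary directions \<open>v\<close> and \<open>w\<close>.  The group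
  \<open>Spin\<^sub>8\<close> contains an element acting by \<open>(x, y) \<mapsto> (s x, s\<^sup>* y)\<close>; it carries \<open>o\<close> to \<open>(s, s\<^sup>*)\<close>.
  Pulling \<open>(t, t\<^sup>*)\<close> back by it shows that \<open>(t, t\<^sup>*)\<close> is antipodal to \<open>(s, s\<^sup>*)\<close> only if \<open>s\<^sup>* t\<close> is
  \<open>1\<close> or has real part \<open>-1/2\<close> (lemma \<open>antipodal_pair_iff\<close>).  That real part is
  \<open>s \<bullet> t = 1/4 + 3/4 (v \<bullet> w)\<close>, so \<open>v \<bullet> w = \<plusminus>1\<close> and \<open>w = \<plusminus>v\<close>.  Therefore an antipodal set
  containing \<open>o\<close> lies in the three-element set of a single \<open>v\<close>.  These three-element sets are
  antipodal themselves, because \<open>1\<close>, \<open>s\<close>, \<open>s\<^sup>*\<close> form a group of order three, and so they are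
  the maximal ones.

  Two structural facts make this rigorous.  The action of \<open>Spin\<^sub>8\<close> is transitive, so that the
  transformations attached to automorphisms and the groups at all points exist; its elements are
  produced by the Moufang identity \<open>a((x y)a) = (a x)(y a)\<close> and by applying triality.  And triality
  fixes the isotropy group of \<open>o\<close> pointwise, so that the group at \<open>g\<cdot>o\<close> does not depend on \<open>g\<close>.

  The outer involution exchanges the matrices acting on the two factors, so it acts as the swap
  \<open>(x, y) \<mapsto> (y, x)\<close>.
\<close>


section \<open>Octonion identities\<close>

lemma oct_cnj_nth: "oct_cnj x $ k = (if k = 0 then x $ 0 else - x $ k)"
proof -
  have "oct_cnj x $ k = (\<Sum>j\<in>UNIV. if j = k then (if k = 0 then x $ 0 else - x $ k) else 0)"
    unfolding oct_cnj_def kappa_def matrix_vector_mult_def vec_lambda_beta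
    by (rule sum.cong) auto
  then show ?thesis by simp
qed

interpretation oct_mult: bounded_bilinear "(\<odot>)"
proof
  show "\<exists>K. \<forall>x y. norm (x \<odot> y) \<le> norm x * norm y * K"
    by (rule exI[of _ 1]) (simp add: norm_oct_mult)
qed (simp_all add: vec_eq_iff all_index8 oct_mult_def algebra_simps)

lemma linear_oct_cnj: "linear oct_cnj"
  unfolding oct_cnj_def by (rule matrix_vector_mul_linear)

lemmas oct_cnj_linear_simps =
  linear_add[OF linear_oct_cnj] linear_diff[OF linear_oct_cnj] linear_neg[OF linear_oct_cnj]
  linear_cmul[OF linear_oct_cnj] linear_0[OF linear_oct_cnj]

lemma oct_cnj_eq: "oct_cnj x = (2 * (oct_one \<bullet> x)) *\<^sub>R oct_one - x"
  by (simp add: vec_eq_iff all_index8 oct_cnj_nth oct_one_def axis_def inner_vec_def sum_index8)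

lemma oct_cnj_cnj [simp]: "oct_cnj (oct_cnj x) = x"
  by (simp add: vec_eq_iff oct_cnj_nth)

lemma oct_cnj_one [simp]: "oct_cnj oct_one = oct_one"
  by (simp add: vec_eq_iff oct_cnj_nth oct_one_def axis_def)

lemma norm_oct_one [simp]: "norm oct_one = 1"
  by (simp add: oct_one_def)

lemma inner_oct_cnj: "oct_cnj x \<bullet> oct_cnj y = x \<bullet> y"
  by (simp add: inner_vec_def oct_cnj_nth sum_index8)

lemma norm_oct_cnj [simp]: "norm (oct_cnj x) = norm x"
  by (simp add: norm_eq_sqrt_inner inner_oct_cnj)

lemma oct_cnj_mult: "oct_cnj (x \<odot> y) = oct_cnj y \<odot> oct_cnj x"
  by (simp add: vec_eq_iff all_index8 oct_cnj_nth oct_mult_def algebra_simps)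

lemma inner_oct_mult_left: "(x \<odot> y) \<bullet> z = y \<bullet> (oct_cnj x \<odot> z)"
  unfolding inner_vec_def sum_index8
  by (simp add: oct_cnj_nth oct_mult_def algebra_simps)

lemma inner_oct_mult_right: "(x \<odot> y) \<bullet> z = x \<bullet> (z \<odot> oct_cnj y)"
  using inner_oct_mult_left[of "oct_cnj y" "oct_cnj x" "oct_cnj z"]
  by (simp add: inner_oct_cnj flip: oct_cnj_mult) (metis inner_oct_cnj oct_cnj_cnj oct_cnj_mult)

lemma inner_mult_same: "(x \<odot> y) \<bullet> (x \<odot> z) = (norm x)\<^sup>2 * (y \<bullet> z)"
proof -
  have "(norm (x \<odot> (y + z)))\<^sup>2 = (norm x)\<^sup>2 * (norm (y + z))\<^sup>2"
    and "(norm (x \<odot> y))\<^sup>2 = (norm x)\<^sup>2 * (norm y)\<^sup>2"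
    and "(norm (x \<odot> z))\<^sup>2 = (norm x)\<^sup>2 * (norm z)\<^sup>2"
    by (simp_all add: norm_oct_mult power_mult_distrib)
  then show ?thesis
    by (simp add: oct_mult.add_right power2_norm_eq_inner inner_simps inner_commute algebra_simps)
qed

text \<open>
  Polarization of \<^term>\<open>norm (x \<odot> y) = norm x * norm y\<close> in both arguments.  It exchanges a factor
  between two products, which takes the place of associativity in what follows.
\<close>

lemma inner_exchange:
  "(x \<odot> y) \<bullet> (x' \<odot> y') + (x' \<odot> y) \<bullet> (x \<odot> y') = 2 * (x \<bullet> x') * (y \<bullet> y')"
  using inner_mult_same[of "x + x'" y y'] inner_mult_same[of x y y'] inner_mult_same[of x' y y']
  by (simp add: oct_mult.add_left power2_norm_eq_inner inner_simps inner_commute algebra_simps)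

text \<open>
  Multiplication by \<open>x\<^sup>*\<close> is adjoint to multiplication by \<open>x\<close>, and multiplication by \<open>x\<close> scales the
  inner product by \<open>(norm x)\<^sup>2\<close>.  The cancellation and alternative laws follow from this.
\<close>

lemma cnj_mult_mult: "oct_cnj x \<odot> (x \<odot> y) = (norm x)\<^sup>2 *\<^sub>R y"
proof (rule vector_eq_rdot[THEN iffD1], rule allI)
  fix z
  show "(oct_cnj x \<odot> (x \<odot> y)) \<bullet> z = ((norm x)\<^sup>2 *\<^sub>R y) \<bullet> z"
    by (simp add: inner_oct_mult_left[of "oct_cnj x"] inner_mult_same)
qed

lemma mult_cnj_mult: "x \<odot> (oct_cnj x \<odot> y) = (norm x)\<^sup>2 *\<^sub>R y"
  using cnj_mult_mult[of "oct_cnj x" y] by simp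

lemma mult_mult_cnj: "(y \<odot> x) \<odot> oct_cnj x = (norm x)\<^sup>2 *\<^sub>R y"
  using arg_cong[OF mult_cnj_mult[of x "oct_cnj y"], of oct_cnj]
  by (simp add: oct_cnj_mult oct_cnj_linear_simps)

lemma mult_cnj_mult_right: "(y \<odot> oct_cnj x) \<odot> x = (norm x)\<^sup>2 *\<^sub>R y"
  using mult_mult_cnj[of y "oct_cnj x"] by simp

lemma oct_mult_cnj: "x \<odot> oct_cnj x = (norm x)\<^sup>2 *\<^sub>R oct_one"
  using mult_mult_cnj[of oct_one x] by simp

lemma oct_square: "a \<odot> a = (2 * (oct_one \<bullet> a)) *\<^sub>R a - (norm a)\<^sup>2 *\<^sub>R oct_one"
  using oct_mult_cnj[of a]
  by (simp add: oct_cnj_eq oct_mult.diff_right oct_mult.scaleR_right algebra_simps)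

lemma left_alternative: "a \<odot> (a \<odot> x) = (a \<odot> a) \<odot> x"
  using cnj_mult_mult[of a x]
  by (simp add: oct_cnj_eq oct_square oct_mult.diff_left oct_mult.scaleR_left algebra_simps)

lemma right_alternative: "(x \<odot> a) \<odot> a = x \<odot> (a \<odot> a)"
  using mult_mult_cnj[of x a]
  by (simp add: oct_cnj_eq oct_square oct_mult.diff_right oct_mult.scaleR_right algebra_simps)

text \<open>
  The right-hand side depends on \<open>x\<close> and \<open>y\<close> only through \<open>x \<odot> y\<close>.  This is the reason for the
  Moufang identity below: replacing \<open>x, y\<close> by \<open>1, x \<odot> y\<close> does not change the value.
\<close>

lemma middle_product:
  "(a \<odot> x) \<odot> (y \<odot> a)
    = (2 * (oct_cnj (x \<odot> y) \<bullet> a)) *\<^sub>R a - (norm a)\<^sup>2 *\<^sub>R oct_cnj (x \<odot> y)"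
proof (rule vector_eq_rdot[THEN iffD1], rule allI)
  fix z
  let ?u = "oct_cnj (a \<odot> x)"
  have "((a \<odot> x) \<odot> (y \<odot> a)) \<bullet> z = (y \<odot> a) \<bullet> (?u \<odot> z)"
    by (rule inner_oct_mult_left)
  also have "\<dots> = 2 * (y \<bullet> ?u) * (a \<bullet> z) - (?u \<odot> a) \<bullet> (y \<odot> z)"
    using inner_exchange[of y a ?u z] by simp
  also have "y \<bullet> ?u = oct_cnj (x \<odot> y) \<bullet> a"
    using inner_oct_mult_left[of a x "oct_cnj y"] inner_oct_mult_right[of "oct_cnj x" "oct_cnj a" y]
     inner_oct_mult_left[of "oct_cnj x" "oct_cnj a" y] inner_oct_cnj[of "x \<odot> y" "oct_cnj a"]
    by (simp add: oct_cnj_mult inner_commute)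
  also have "?u \<odot> a = (norm a)\<^sup>2 *\<^sub>R oct_cnj x"
    by (simp add: oct_cnj_mult mult_cnj_mult_right)
  also have "((norm a)\<^sup>2 *\<^sub>R oct_cnj x) \<bullet> (y \<odot> z) = (norm a)\<^sup>2 * (oct_cnj (x \<odot> y) \<bullet> z)"
    using inner_oct_mult_left[of y z "oct_cnj x"] by (simp add: oct_cnj_mult inner_commute)
  finally show "((a \<odot> x) \<odot> (y \<odot> a)) \<bullet> z
      = ((2 * (oct_cnj (x \<odot> y) \<bullet> a)) *\<^sub>R a - (norm a)\<^sup>2 *\<^sub>R oct_cnj (x \<odot> y)) \<bullet> z"
    by (simp add: inner_simps)
qed

lemma moufang_identity: "a \<odot> ((x \<odot> y) \<odot> a) = (a \<odot> x) \<odot> (y \<odot> a)"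
  using middle_product[of a x y] middle_product[of a oct_one "x \<odot> y"] by simp

text \<open>
  The square root of \<open>a\<close> is the direction halfway between \<open>1\<close> and \<open>a\<close>.  For \<open>a = -1\<close> there is no such
  direction, but every imaginary unit is a root.
\<close>

lemma unit_square_root:
  assumes "norm a = 1"
  obtains b where "norm b = 1" "b \<odot> b = a"
proof (cases "a = - oct_one")
  case True
  let ?e = "axis 1 1 :: octonion"
  have "oct_one \<bullet> ?e = 0" "norm ?e = 1"
    by (simp_all add: oct_one_def inner_axis_axis)
  then have "?e \<odot> ?e = a"
    using True by (simp add: oct_square)
  with \<open>norm ?e = 1\<close> show ?thesis by (rule that)
next
  case False
  then have n0: "norm (oct_one + a) \<noteq> 0"
    by (metis add_eq_0_iff norm_eq_zero)
  have n2: "(norm (oct_one + a))\<^sup>2 = 2 + 2 * (oct_one \<bullet> a)"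
    using assms norm_oct_one unfolding norm_eq_1
    by (simp add: power2_norm_eq_inner inner_simps inner_commute)
  have sq: "(oct_one + a) \<odot> (oct_one + a) = (norm (oct_one + a))\<^sup>2 *\<^sub>R a"
    unfolding n2 using assms
    by (simp add: oct_mult.add_left oct_mult.add_right oct_square[of a] scaleR_left_distrib scaleR_2)
  let ?b = "(1 / norm (oct_one + a)) *\<^sub>R (oct_one + a)"
  have "?b \<odot> ?b = a"
    using n0 by (simp add: oct_mult.scaleR_left oct_mult.scaleR_right sq power2_eq_square)
  moreover have "norm ?b = 1"
    using n0 by simp
  ultimately show ?thesis by (rule that[rotated])
qed

text \<open>
  Take \<open>b\<close> orthogonal to \<open>1\<close> and \<open>x\<close>, and \<open>a = b\<^sup>* x\<close>: the real part of \<open>a\<close> is \<open>b \<bullet> x = 0\<close>.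
\<close>

lemma unit_eq_imaginary_product:
  assumes "norm x = 1"
  obtains a b where "norm a = 1" "oct_one \<bullet> a = 0" "norm b = 1" "oct_one \<bullet> b = 0" "b \<odot> a = x"
proof -
  have "dim {oct_one, x} < DIM(octonion)"
    using dim_le_card[of "{oct_one, x}" "{oct_one, x}"] card_insert_le_m1[of 2 "{x}" oct_one]
    by (auto simp: span_superset)
  then obtain c where c: "c \<noteq> 0" "\<And>y. y \<in> span {oct_one, x} \<Longrightarrow> orthogonal c y"
    using orthogonal_to_subspace_exists by blast
  define b where "b = (1 / norm c) *\<^sub>R c"
  have b: "norm b = 1" "oct_one \<bullet> b = 0" "x \<bullet> b = 0"
    using c(1) c(2)[of oct_one] c(2)[of x]
    by (auto simp: b_def orthogonal_def inner_commute span_base)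
  have "oct_one \<bullet> (oct_cnj b \<odot> x) = 0"
    using inner_oct_mult_left[of b oct_one x] b(3) by (simp add: inner_commute)
  moreover have "norm (oct_cnj b \<odot> x) = 1"
    using b(1) assms by (simp add: norm_oct_mult)
  moreover have "b \<odot> (oct_cnj b \<odot> x) = x"
    using b(1) by (simp add: mult_cnj_mult)
  ultimately show ?thesis
    using b that by blast
qed


section \<open>Rotations by octonion multiplication\<close>

definition left_mult :: "octonion \<Rightarrow> real ^ 8 ^ 8" where
  "left_mult a = matrix (\<lambda>x. a \<odot> x)"

definition right_mult :: "octonion \<Rightarrow> real ^ 8 ^ 8" where
  "right_mult a = matrix (\<lambda>x. x \<odot> a)"

lemma left_mult_apply [simp]: "left_mult a *v x = a \<odot> x"
  unfolding left_mult_def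
  by (rule matrix_works) (simp add: linear_matrix_vector_mul_eq bounded_linear.linear[OF oct_mult.bounded_linear_right])

lemma right_mult_apply [simp]: "right_mult a *v x = x \<odot> a"
  unfolding right_mult_def
  by (rule matrix_works) (simp add: linear_matrix_vector_mul_eq bounded_linear.linear[OF oct_mult.bounded_linear_left])

lemma orthogonal_matrix_iff_norm:
  "orthogonal_matrix (A :: real ^ 'n ^ 'n) \<longleftrightarrow> (\<forall>x. norm (A *v x) = norm x)"
  using orthogonal_transformation_matrix[of "(*v) A"] orthogonal_transformation[of "(*v) A"]
  by (simp add: matrix_vector_mul_linear)

lemma rotation_matrix_mult:
  "rotation_matrix A \<Longrightarrow> rotation_matrix B \<Longrightarrow> rotation_matrix (A ** B)"
  for A B :: "real ^ 'n ^ 'n"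
  by (simp add: rotation_matrix_def orthogonal_matrix_mul det_mul)

lemma norm_rotation: "rotation_matrix A \<Longrightarrow> norm (A *v x) = norm x"
  for A :: "real ^ 'n ^ 'n"
  by (simp add: rotation_matrix_def orthogonal_matrix_iff_norm)

lemma rotation_matrix_square:
  fixes A :: "real ^ 'n ^ 'n"
  assumes "orthogonal_matrix A"
  shows "rotation_matrix (A ** A)"
  using det_orthogonal_matrix[OF assms] assms
  by (auto simp: rotation_matrix_def orthogonal_matrix_mul det_mul)

text \<open>
  The determinant is a square because \<open>a\<close> has a square root \<open>b\<close>, and by alternativity
  multiplication by \<open>a\<close> is multiplication by \<open>b\<close> applied twice.
\<close>

lemma rotation_left_mult:
  assumes "norm a = 1"
  shows "rotation_matrix (left_mult a)"
proof -
  obtain b where b: "norm b = 1" "b \<odot> b = a"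
    using unit_square_root[OF assms] .
  have "left_mult a = left_mult b ** left_mult b"
    using b(2) by (simp add: matrix_eq left_alternative flip: matrix_vector_mul_assoc)
  moreover have "orthogonal_matrix (left_mult b)"
    using b(1) by (simp add: orthogonal_matrix_iff_norm norm_oct_mult)
  ultimately show ?thesis
    by (simp add: rotation_matrix_square)
qed

lemma rotation_right_mult:
  assumes "norm a = 1"
  shows "rotation_matrix (right_mult a)"
proof -
  obtain b where b: "norm b = 1" "b \<odot> b = a"
    using unit_square_root[OF assms] .
  have "right_mult a = right_mult b ** right_mult b"
    using b(2) by (simp add: matrix_eq right_alternative flip: matrix_vector_mul_assoc)
  moreover have "orthogonal_matrix (right_mult b)"
    using b(1) by (simp add: orthogonal_matrix_iff_norm norm_oct_mult)
  ultimately show ?thesis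
    by (simp add: rotation_matrix_square)
qed


section \<open>The group Spin(8) and triality\<close>

lemma mem_Spin8:
  "(A, B, C) \<in> carrier Spin8 \<longleftrightarrow>
    rotation_matrix A \<and> rotation_matrix B \<and> rotation_matrix C \<and>
    (\<forall>x y. B *v (x \<odot> y) = (C *v x) \<odot> (A *v y))"
  by (simp add: Spin8_def)

lemma mult_Spin8 [simp]:
  "(A, B, C) \<otimes>\<^bsub>Spin8\<^esub> (A', B', C') = (A ** A', B ** B', C ** C')"
  by (simp add: Spin8_def)

lemma one_Spin8: "\<one>\<^bsub>Spin8\<^esub> = (mat 1, mat 1, mat 1)"
  by (simp add: Spin8_def)

lemma transpose_rotation_cancel:
  fixes A :: "real ^ 'n ^ 'n"
  assumes "rotation_matrix A"
  shows "transpose A ** A = mat 1" "A ** transpose A = mat 1" "rotation_matrix (transpose A)"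
    "A *v (transpose A *v x) = x" "transpose A *v (A *v x) = x"
  using assms
  by (auto simp: rotation_matrix_def orthogonal_matrix_def det_transpose matrix_vector_mul_assoc
      simp del: transpose_matrix_vector)

interpretation Spin8: group Spin8
proof (rule groupI)
  fix g h
  assume "g \<in> carrier Spin8" "h \<in> carrier Spin8"
  then show "g \<otimes>\<^bsub>Spin8\<^esub> h \<in> carrier Spin8"
    by (cases g; cases h)
      (simp add: mem_Spin8 rotation_matrix_mult flip: matrix_vector_mul_assoc)
next
  show "\<one>\<^bsub>Spin8\<^esub> \<in> carrier Spin8"
    by (simp add: one_Spin8 mem_Spin8 rotation_matrix_def orthogonal_matrix_id)
next
  fix g h k
  show "g \<otimes>\<^bsub>Spin8\<^esub> h \<otimes>\<^bsub>Spin8\<^esub> k = g \<otimes>\<^bsub>Spin8\<^esub> (h \<otimes>\<^bsub>Spin8\<^esub> k)"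
    by (cases g; cases h; cases k) (simp add: matrix_mul_assoc)
next
  fix g
  show "\<one>\<^bsub>Spin8\<^esub> \<otimes>\<^bsub>Spin8\<^esub> g = g"
    by (cases g) (simp add: one_Spin8)
next
  fix g
  assume g: "g \<in> carrier Spin8"
  obtain A B C where [simp]: "g = (A, B, C)"
    by (cases g)
  let ?h = "(transpose A, transpose B, transpose C)"
  note rot = g[simplified, unfolded mem_Spin8]
  have "transpose B *v (x \<odot> y) = (transpose C *v x) \<odot> (transpose A *v y)" for x y
  proof -
    have "B *v ((transpose C *v x) \<odot> (transpose A *v y)) = x \<odot> y"
      using rot by (simp add: transpose_rotation_cancel del: transpose_matrix_vector)
    then show ?thesis
      using rot transpose_rotation_cancel(5) by metis
  qed
  with rot have "?h \<in> carrier Spin8"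
    by (simp add: mem_Spin8 transpose_rotation_cancel)
  moreover have "?h \<otimes>\<^bsub>Spin8\<^esub> g = \<one>\<^bsub>Spin8\<^esub>"
    using rot by (simp add: one_Spin8 transpose_rotation_cancel)
  ultimately show "\<exists>h\<in>carrier Spin8. h \<otimes>\<^bsub>Spin8\<^esub> g = \<one>\<^bsub>Spin8\<^esub>" by blast
qed

lemma spin_act_mult: "spin_act (g \<otimes>\<^bsub>Spin8\<^esub> h) p = spin_act g (spin_act h p)"
  by (cases g; cases h; cases p) (simp add: matrix_vector_mul_assoc)

lemma spin_act_one [simp]: "spin_act \<one>\<^bsub>Spin8\<^esub> p = p"
  by (cases p) (simp add: one_Spin8)

lemma spin_act_inv:
  assumes "g \<in> carrier Spin8"
  shows "spin_act (inv\<^bsub>Spin8\<^esub> g) (spin_act g p) = p" "spin_act g (spin_act (inv\<^bsub>Spin8\<^esub> g) p) = p"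
  using assms by (simp_all flip: spin_act_mult)

lemma mem_S7xS7 [simp]: "(x, y) \<in> S7xS7 \<longleftrightarrow> norm x = 1 \<and> norm y = 1"
  by (simp add: S7xS7_def sphere7_def)

lemma spin_act_S7xS7:
  assumes "g \<in> carrier Spin8" "p \<in> S7xS7"
  shows "spin_act g p \<in> S7xS7"
  using assms by (cases g; cases p) (simp add: mem_Spin8 norm_rotation)

lemma kappa_mult_vec: "kappa *v x = oct_cnj x"
  by (simp add: oct_cnj_def)

lemma kappa_conj_apply [simp]: "kappa_conj D *v x = oct_cnj (D *v oct_cnj x)"
  by (simp add: kappa_conj_def kappa_mult_vec flip: matrix_vector_mul_assoc)

lemma kappa_conj_mult: "kappa_conj (A ** B) = kappa_conj A ** kappa_conj B"
  by (simp add: matrix_eq flip: matrix_vector_mul_assoc)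

lemma kappa_conj_kappa_conj [simp]: "kappa_conj (kappa_conj A) = A"
  by (simp add: matrix_eq)

lemma rotation_kappa_conj:
  assumes "rotation_matrix D"
  shows "rotation_matrix (kappa_conj D)"
proof -
  have "orthogonal_matrix kappa"
    by (simp add: orthogonal_matrix_iff_norm kappa_mult_vec)
  then have "orthogonal_matrix (kappa_conj D)" "(det kappa)\<^sup>2 = 1"
    using assms det_orthogonal_matrix[of kappa]
    by (auto simp: kappa_conj_def rotation_matrix_def orthogonal_matrix_mul)
  then show ?thesis
    using assms by (simp add: kappa_conj_def rotation_matrix_def det_mul power2_eq_square)
qed

lemma triality_eq:
  "(A, B, C) \<in> carrier Spin8 \<Longrightarrow> triality (A, B, C) = (kappa_conj B, kappa_conj C, A)"
  by (simp add: triality_def)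

text \<open>
  Solving \<open>B(u x) = (C u)(A x)\<close> for \<open>C u\<close>, by multiplying with the conjugate of \<open>A x\<close> on the right,
  gives the same kind of relation with the three matrices permuted.
\<close>

lemma triality_Spin8:
  assumes "g \<in> carrier Spin8"
  shows "triality g \<in> carrier Spin8"
proof -
  obtain A B C where g: "g = (A, B, C)"
    by (cases g)
  note spin = assms[unfolded g mem_Spin8]
  have "oct_cnj (C *v oct_cnj (x \<odot> y)) = (A *v x) \<odot> oct_cnj (B *v oct_cnj y)" for x y
  proof (cases "x = 0")
    case True
    then show ?thesis
      by (simp add: oct_mult.zero_left oct_cnj_linear_simps)
  next
    case False
    let ?u = "oct_cnj (x \<odot> y)"
    have "?u \<odot> x = (norm x)\<^sup>2 *\<^sub>R oct_cnj y"
      by (simp add: oct_cnj_mult mult_cnj_mult_right)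
    then have "(norm x)\<^sup>2 *\<^sub>R (B *v oct_cnj y) = (C *v ?u) \<odot> (A *v x)"
      using spin by (metis matrix_vector_mult_scaleR)
    then have "(norm x)\<^sup>2 *\<^sub>R ((B *v oct_cnj y) \<odot> oct_cnj (A *v x)) = (norm x)\<^sup>2 *\<^sub>R (C *v ?u)"
      using spin by (simp add: mult_mult_cnj norm_rotation flip: oct_mult.scaleR_left)
    then have "(B *v oct_cnj y) \<odot> oct_cnj (A *v x) = C *v ?u"
      using False by simp
    then show ?thesis
      by (metis oct_cnj_cnj oct_cnj_mult)
  qed
  with spin assms show ?thesis
    by (simp add: g triality_eq mem_Spin8 rotation_kappa_conj)
qed

lemma triality_cubed:
  assumes "g \<in> carrier Spin8"
  shows "triality (triality (triality g)) = g"
proof -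
  obtain A B C where g: "g = (A, B, C)"
    by (cases g)
  show ?thesis
    using assms triality_Spin8[OF assms] triality_Spin8[OF triality_Spin8[OF assms]]
    by (simp add: g triality_eq)
qed

lemma triality_mult:
  assumes "g \<in> carrier Spin8" "h \<in> carrier Spin8"
  shows "triality (g \<otimes>\<^bsub>Spin8\<^esub> h) = triality g \<otimes>\<^bsub>Spin8\<^esub> triality h"
  using assms Spin8.m_closed[OF assms]
  by (cases g; cases h) (simp add: triality_eq kappa_conj_mult)

lemma triality_auto: "triality \<in> auto Spin8"
proof -
  have "bij_betw triality (carrier Spin8) (carrier Spin8)"
    by (rule bij_betw_byWitness[where f' = "\<lambda>g. triality (triality g)"])
      (auto simp: triality_cubed triality_Spin8)
  then show ?thesis
    by (auto simp: auto_def hom_def Bij_def triality_mult triality_Spin8) (simp add: triality_def)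
qed

interpretation AutSpin8: group "AutoGroup Spin8"
  by (rule Spin8.AutoGroup)

lemma mult_AutSpin8:
  assumes "\<gamma> \<in> auto Spin8" "\<delta> \<in> auto Spin8" "g \<in> carrier Spin8"
  shows "(\<gamma> \<otimes>\<^bsub>AutoGroup Spin8\<^esub> \<delta>) g = \<gamma> (\<delta> g)"
  using assms by (simp add: AutoGroup_def BijGroup_def auto_def compose_def)

lemma carrier_AutSpin8: "carrier (AutoGroup Spin8) = auto Spin8"
  by (simp add: AutoGroup_def)

lemma funpow_triality_Spin8: "g \<in> carrier Spin8 \<Longrightarrow> (triality ^^ n) g \<in> carrier Spin8"
  by (induction n) (auto simp: triality_Spin8)

lemma triality_inv:
  assumes "g \<in> carrier Spin8"
  shows "(inv\<^bsub>AutoGroup Spin8\<^esub> triality) g = triality (triality g)"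
proof -
  let ?i = "inv\<^bsub>AutoGroup Spin8\<^esub> triality"
  have i: "?i \<in> auto Spin8"
    using AutSpin8.inv_closed triality_auto unfolding carrier_AutSpin8 by blast
  let ?h = "triality (triality g)"
  have h: "?h \<in> carrier Spin8"
    using assms by (simp add: triality_Spin8)
  have "?i g = ?i (triality ?h)"
    using assms by (simp add: triality_cubed)
  also have "\<dots> = (?i \<otimes>\<^bsub>AutoGroup Spin8\<^esub> triality) ?h"
    using mult_AutSpin8[OF i triality_auto h] by simp
  also have "\<dots> = ?h"
    using AutSpin8.l_inv[of triality] triality_auto h
    by (simp add: carrier_AutSpin8) (simp add: AutoGroup_def BijGroup_def)
  finally show ?thesis .
qed

text \<open>
  The inverse of triality is its square, so natural powers suffice.
\<close>

lemma triality_group_powers: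
  assumes "\<gamma> \<in> triality_group"
  shows "\<exists>n. \<forall>g\<in>carrier Spin8. \<gamma> g = (triality ^^ n) g"
  using assms unfolding triality_group_def
proof (induction rule: generate.induct)
  case one
  show ?case
    by (rule exI[of _ 0]) (simp add: AutoGroup_def BijGroup_def)
next
  case (incl \<gamma>)
  then show ?case
    by (auto intro: exI[of _ 1])
next
  case (inv \<gamma>)
  then show ?case
    by (auto simp: triality_inv intro: exI[of _ 2] simp: numeral_2_eq_2)
next
  case (eng \<gamma> \<delta>)
  then obtain m n where *: "\<forall>g\<in>carrier Spin8. \<gamma> g = (triality ^^ m) g" "\<forall>g\<in>carrier Spin8. \<delta> g = (triality ^^ n) g"
    by blast
  have "\<gamma> \<in> auto Spin8" "\<delta> \<in> auto Spin8"
    using eng.hyps AutSpin8.generate_in_carrier[of "{triality}"] triality_auto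
    by (auto simp: carrier_AutSpin8)
  then have "\<forall>g\<in>carrier Spin8. (\<gamma> \<otimes>\<^bsub>AutoGroup Spin8\<^esub> \<delta>) g = (triality ^^ (m + n)) g"
    using * by (simp add: mult_AutSpin8 funpow_triality_Spin8 funpow_add)
  then show ?case ..
qed

lemma triality_in_triality_group: "triality \<in> triality_group"
  unfolding triality_group_def by (rule generate.incl) simp


section \<open>The action on the product of spheres\<close>

text \<open>
  The transformation of \<^const>\<open>S7xS7\<close> induced by \<^const>\<open>triality\<close>; see \<open>aut_act_triality\<close> below.
\<close>

definition triality_transf :: "octonion \<times> octonion \<Rightarrow> octonion \<times> octonion" where
  "triality_transf = (\<lambda>(x, y). (oct_cnj y, x \<odot> oct_cnj y))"

text \<open>
  In the second component this is the relation defining \<^const>\<open>Spin8\<close>, for the triple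
  \<^term>\<open>triality g\<close> and the product of \<open>x\<close> and \<open>y\<^sup>*\<close>.
\<close>

lemma triality_transf_equivariant:
  assumes "g \<in> carrier Spin8"
  shows "triality_transf (spin_act g p) = spin_act (triality g) (triality_transf p)"
proof -
  obtain A B C where g: "g = (A, B, C)"
    by (cases g)
  obtain x y where p: "p = (x, y)"
    by (cases p)
  have "(kappa_conj B, kappa_conj C, A) \<in> carrier Spin8"
    using triality_Spin8[OF assms] assms by (simp add: g triality_eq)
  then have "kappa_conj C *v (x \<odot> oct_cnj y) = (A *v x) \<odot> (kappa_conj B *v oct_cnj y)"
    unfolding mem_Spin8 by blast
  then show ?thesis
    using assms by (simp add: g p triality_eq triality_transf_def)
qed

lemma triality_transf_base_pt [simp]: "triality_transf base_pt = base_pt"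
  by (simp add: triality_transf_def base_pt_def)

lemma funpow_triality_transf_equivariant:
  assumes "g \<in> carrier Spin8"
  shows "(triality_transf ^^ n) (spin_act g p) = spin_act ((triality ^^ n) g) ((triality_transf ^^ n) p)"
  by (induction n) (simp_all add: triality_transf_equivariant funpow_triality_Spin8 assms)

lemma funpow_triality_transf_base_pt [simp]: "(triality_transf ^^ n) base_pt = base_pt"
  by (induction n) simp_all

definition moufang_triple :: "octonion \<Rightarrow> mat_triple" where
  "moufang_triple a = (right_mult a, left_mult a ** right_mult a, left_mult a)"

text \<open>
  The Moufang identity is the defining relation of \<^const>\<open>Spin8\<close> for this triple.
\<close>

lemma moufang_triple_Spin8:
  assumes "norm a = 1"
  shows "moufang_triple a \<in> carrier Spin8"
  using assms
  by (simp add: moufang_triple_def mem_Spin8 rotation_left_mult rotation_right_mult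
      rotation_matrix_mult moufang_identity flip: matrix_vector_mul_assoc)

lemma moufang_triple_act:
  "spin_act (moufang_triple a) (x, y) = (x \<odot> a, a \<odot> (y \<odot> a))"
  by (simp add: moufang_triple_def flip: matrix_vector_mul_assoc)

text \<open>
  For imaginary units \<open>a\<close> and \<open>b\<close>, the map \<open>w \<mapsto> a(w a)\<close> and its analogue for \<open>b\<close> send \<open>1\<close> to \<open>-1\<close>.
  So the product of their Moufang triples returns the second component to \<open>1\<close>, while the first one
  becomes \<open>b \<odot> a\<close>, which is an arbitrary unit.
\<close>

lemma transitive_first_factor:
  assumes "norm x = 1"
  obtains g where "g \<in> carrier Spin8" "spin_act g base_pt = (x, oct_one)"
proof -
  obtain a b where ab: "norm a = 1" "oct_one \<bullet> a = 0" "norm b = 1" "oct_one \<bullet> b = 0" "b \<odot> a = x"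
    using unit_eq_imaginary_product[OF assms] .
  let ?g = "moufang_triple a \<otimes>\<^bsub>Spin8\<^esub> moufang_triple b"
  have "spin_act ?g base_pt = (x, oct_one)"
    using ab by (simp add: base_pt_def spin_act_mult moufang_triple_act oct_square
      oct_mult.minus_left oct_mult.minus_right)
  moreover have "?g \<in> carrier Spin8"
    using ab by (simp add: moufang_triple_Spin8)
  ultimately show ?thesis by (rule that[rotated])
qed

text \<open>
  Triality sends \<open>(z, 1)\<close> to \<open>(1, z)\<close>, so the points \<open>(1, z)\<close> are in the orbit too.  An element \<open>g\<close>
  carrying \<open>o\<close> to \<open>(x, 1)\<close> then carries \<open>(1, z)\<close> to \<open>(x, y)\<close> for a suitable \<open>z\<close>.
\<close>

lemma Spin8_transitive:
  assumes "p \<in> S7xS7"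
  obtains g where "g \<in> carrier Spin8" "spin_act g base_pt = p"
proof -
  obtain x y where p: "p = (x, y)" "norm x = 1" "norm y = 1"
    using assms by (cases p) simp
  obtain g where g: "g \<in> carrier Spin8" "spin_act g base_pt = (x, oct_one)"
    using transitive_first_factor[OF p(2)] .
  obtain A B C where ABC: "g = (A, B, C)"
    by (cases g)
  let ?z = "transpose B *v y"
  have B: "rotation_matrix B"
    using g(1) by (simp add: ABC mem_Spin8)
  have Bz: "B *v ?z = y"
    using B by (rule transpose_rotation_cancel)
  then have "norm ?z = 1"
    using norm_rotation[OF B, of ?z] p(3) by simp
  then obtain h where h: "h \<in> carrier Spin8" "spin_act h base_pt = (?z, oct_one)"
    using transitive_first_factor by blast
  have "spin_act (triality h) base_pt = triality_transf (spin_act h base_pt)"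
    using h(1) by (simp add: triality_transf_equivariant)
  also have "\<dots> = (oct_one, ?z)"
    unfolding h(2) by (simp add: triality_transf_def)
  finally have "spin_act (g \<otimes>\<^bsub>Spin8\<^esub> triality h) base_pt = p"
    using g(2) Bz by (simp add: spin_act_mult ABC p(1) base_pt_def del: transpose_matrix_vector)
  then show ?thesis
    using that g(1) h(1) triality_Spin8 by blast
qed

text \<open>
  Transitivity provides the element \<open>g\<close> in the definition of \<^const>\<open>aut_act\<close>, and a formula for
  \<open>\<gamma>(g)\<cdot>o\<close> in terms of \<open>g\<cdot>o\<close> shows that its choice does not matter.
\<close>

lemma aut_act_eqI:
  assumes "\<And>g. g \<in> carrier Spin8 \<Longrightarrow> spin_act (\<gamma> g) base_pt = f (spin_act g base_pt)"
    and "p \<in> S7xS7"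
  shows "aut_act \<gamma> p = f p"
proof -
  obtain g where "g \<in> carrier Spin8" "spin_act g base_pt = p"
    using Spin8_transitive[OF assms(2)] .
  then have "(THE q. \<exists>g\<in>carrier Spin8. spin_act g base_pt = p \<and> q = spin_act (\<gamma> g) base_pt) = f p"
    using assms(1) by (intro the_equality) auto
  then show ?thesis
    using assms(2) by (simp add: aut_act_def)
qed

lemma aut_act_triality_group:
  assumes "\<gamma> \<in> triality_group"
  obtains n where "\<And>p. p \<in> S7xS7 \<Longrightarrow> aut_act \<gamma> p = (triality_transf ^^ n) p"
proof -
  obtain n where n: "\<forall>g\<in>carrier Spin8. \<gamma> g = (triality ^^ n) g"
    using triality_group_powers[OF assms] by blast
  have "aut_act \<gamma> p = (triality_transf ^^ n) p" if "p \<in> S7xS7" for p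
    by (rule aut_act_eqI[OF _ that]) (simp add: n funpow_triality_transf_equivariant)
  then show ?thesis by (rule that)
qed

lemma aut_act_triality: "p \<in> S7xS7 \<Longrightarrow> aut_act triality p = triality_transf p"
  by (rule aut_act_eqI) (simp_all add: triality_transf_equivariant)

lemma aut_act_outer_invol:
  assumes "(x, y) \<in> S7xS7"
  shows "aut_act outer_invol (x, y) = (y, x)"
proof -
  have "spin_act (outer_invol g) base_pt = prod.swap (spin_act g base_pt)"
    if "g \<in> carrier Spin8" for g
    using that by (cases g) (simp add: outer_invol_def base_pt_def)
  then show ?thesis
    using aut_act_eqI[of outer_invol prod.swap] assms by simp
qed

text \<open>
  A triple fixing \<open>o\<close> is \<open>(A, A, A)\<close>, as the defining relation at \<open>x = 1\<close> and at \<open>y = 1\<close> shows.  The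
  orthogonal matrix \<open>A\<close> fixes \<open>1\<close>, so it preserves real parts and commutes with conjugation.
\<close>

lemma triality_isotropy:
  assumes "h \<in> carrier Spin8" "spin_act h base_pt = base_pt"
  shows "triality h = h"
proof -
  obtain A B C where h: "h = (A, B, C)"
    by (cases h)
  have spin: "rotation_matrix A" "\<And>x y. B *v (x \<odot> y) = (C *v x) \<odot> (A *v y)"
    using assms(1) by (auto simp: h mem_Spin8)
  have one: "A *v oct_one = oct_one" "B *v oct_one = oct_one"
    using assms(2) by (auto simp: h base_pt_def)
  have "C *v oct_one = oct_one"
    using spin(2)[of oct_one oct_one] one by simp
  then have AB: "A = B"
    using spin(2)[of oct_one] by (simp add: matrix_eq)
  have BC: "B = C"
    using spin(2)[of _ oct_one] one by (simp add: matrix_eq)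
  have "kappa_conj A *v x = A *v x" for x
  proof -
    have "oct_one \<bullet> (A *v x) = (A *v oct_one) \<bullet> (A *v x)"
      by (simp add: one)
    also have "\<dots> = oct_one \<bullet> x"
      using spin(1) by (simp add: dot_norm norm_rotation flip: matrix_vector_right_distrib)
    finally show ?thesis
      by (simp add: oct_cnj_eq[of x] oct_cnj_eq[of "A *v x"] matrix_vector_mult_diff_distrib
        matrix_vector_mult_scaleR oct_cnj_linear_simps one)
  qed
  then have "kappa_conj A = A"
    by (simp add: matrix_eq)
  with assms(1) AB BC show ?thesis
    by (simp add: h triality_eq)
qed

text \<open>
  The elements \<open>g\<close> and \<open>g'\<close> differ by an \<open>h\<close> in the isotropy group.  Triality fixes \<open>h\<close>, so by
  equivariance its transformation commutes with the action of \<open>h\<close>.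
\<close>

lemma conj_transf_indep:
  assumes "\<gamma> \<in> triality_group" "g \<in> carrier Spin8" "g' \<in> carrier Spin8"
    and "spin_act g base_pt = spin_act g' base_pt"
  shows "conj_transf g (aut_act \<gamma>) = conj_transf g' (aut_act \<gamma>)"
proof -
  let ?h = "inv\<^bsub>Spin8\<^esub> g \<otimes>\<^bsub>Spin8\<^esub> g'"
  have h: "?h \<in> carrier Spin8"
    using assms by simp
  have "spin_act ?h base_pt = base_pt"
    using assms by (simp add: spin_act_mult spin_act_inv flip: assms(4))
  then have "triality ?h = ?h"
    using h by (rule triality_isotropy[rotated])
  then have tri: "(triality ^^ n) ?h = ?h" for n
    by (induction n) simp_all
  have g': "g' = g \<otimes>\<^bsub>Spin8\<^esub> ?h"
    using assms by (simp flip: Spin8.m_assoc)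
  obtain n where n: "\<And>p. p \<in> S7xS7 \<Longrightarrow> aut_act \<gamma> p = (triality_transf ^^ n) p"
    using aut_act_triality_group[OF assms(1)] by blast
  have "spin_act g (aut_act \<gamma> (spin_act (inv\<^bsub>Spin8\<^esub> g) q))
      = spin_act g' (aut_act \<gamma> (spin_act (inv\<^bsub>Spin8\<^esub> g') q))" if q: "q \<in> S7xS7" for q
  proof -
    let ?u = "spin_act (inv\<^bsub>Spin8\<^esub> g') q"
    have u: "?u \<in> S7xS7" "spin_act (inv\<^bsub>Spin8\<^esub> g) q \<in> S7xS7"
      using q assms by (simp_all add: spin_act_S7xS7)
    have hu: "spin_act (inv\<^bsub>Spin8\<^esub> g) q = spin_act ?h ?u"
      using assms by (simp add: spin_act_mult spin_act_inv)
    have "spin_act g ((triality_transf ^^ n) (spin_act ?h ?u)) = spin_act g (spin_act ?h ((triality_transf ^^ n) ?u))"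
      by (simp only: funpow_triality_transf_equivariant[OF h] tri)
    also have "\<dots> = spin_act g' ((triality_transf ^^ n) ?u)"
      by (metis g' spin_act_mult)
    finally show ?thesis
      using u hu by (simp add: n)
  qed
  then show ?thesis
    by (auto simp: conj_transf_def)
qed

lemma Gamma_at_orbit:
  assumes "g \<in> carrier Spin8"
  shows "Gamma_at triality_group (spin_act g base_pt) =
    (\<lambda>\<gamma>. conj_transf g (aut_act \<gamma>)) ` triality_group"
  unfolding Gamma_at_def
proof (rule the_equality)
  show "\<exists>h\<in>carrier Spin8. spin_act h base_pt = spin_act g base_pt \<and>
      (\<lambda>\<gamma>. conj_transf g (aut_act \<gamma>)) ` triality_group = (\<lambda>\<gamma>. conj_transf h (aut_act \<gamma>)) ` triality_group"
    using assms by blast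
next
  fix S
  assume "\<exists>h\<in>carrier Spin8. spin_act h base_pt = spin_act g base_pt \<and>
      S = (\<lambda>\<gamma>. conj_transf h (aut_act \<gamma>)) ` triality_group"
  then obtain h where "h \<in> carrier Spin8" "spin_act h base_pt = spin_act g base_pt"
    and S: "S = (\<lambda>\<gamma>. conj_transf h (aut_act \<gamma>)) ` triality_group"
    by blast
  then show "S = (\<lambda>\<gamma>. conj_transf g (aut_act \<gamma>)) ` triality_group"
    unfolding S using assms by (intro image_cong refl conj_transf_indep)
qed

lemma Fix_Gamma_at_iff:
  assumes "g \<in> carrier Spin8" "q \<in> S7xS7"
  shows "spin_act g q \<in> Fix (Gamma_at triality_group (spin_act g base_pt)) \<longleftrightarrow> triality_transf q = q"
proof -
  have gq: "spin_act g q \<in> S7xS7"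
    using assms by (simp add: spin_act_S7xS7)
  have conj: "conj_transf g f (spin_act g q) = spin_act g (f q)" for f
    using assms gq by (simp add: conj_transf_def spin_act_inv)
  have inj: "spin_act g r = spin_act g q \<longleftrightarrow> r = q" for r
    using assms(1) spin_act_inv(1) by metis
  have "spin_act g q \<in> Fix (Gamma_at triality_group (spin_act g base_pt))
      \<longleftrightarrow> (\<forall>\<gamma>\<in>triality_group. aut_act \<gamma> q = q)"
    using gq by (simp add: Fix_def Gamma_at_orbit[OF assms(1)] conj inj)
  also have "\<dots> \<longleftrightarrow> triality_transf q = q"
  proof
    assume "\<forall>\<gamma>\<in>triality_group. aut_act \<gamma> q = q"
    then show "triality_transf q = q"
      using triality_in_triality_group aut_act_triality[OF assms(2)] by simp
  next
    assume "triality_transf q = q"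
    then have fixed: "(triality_transf ^^ n) q = q" for n
      by (induction n) simp_all
    show "\<forall>\<gamma>\<in>triality_group. aut_act \<gamma> q = q"
    proof
      fix \<gamma> assume "\<gamma> \<in> triality_group"
      then obtain n where "\<And>p. p \<in> S7xS7 \<Longrightarrow> aut_act \<gamma> p = (triality_transf ^^ n) p"
        using aut_act_triality_group by blast
      then show "aut_act \<gamma> q = q"
        using assms(2) fixed by simp
    qed
  qed
  finally show ?thesis .
qed


section \<open>Antipodal points and cube roots of unity\<close>

text \<open>
  The fixed-point equation is \<open>x x = x\<^sup>*\<close>; the quadratic equation of \<open>x\<close> makes it linear.
\<close>

lemma triality_transf_fixed_iff:
  assumes "norm x = 1"
  shows "triality_transf (x, y) = (x, y) \<longleftrightarrow> y = oct_cnj x \<and> (x = oct_one \<or> oct_one \<bullet> x = - 1 / 2)"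
proof -
  have "triality_transf (x, y) = (x, y) \<longleftrightarrow> y = oct_cnj x \<and> x \<odot> x = oct_cnj x"
    by (auto simp: triality_transf_def)
  also have "x \<odot> x = oct_cnj x \<longleftrightarrow> (2 * (oct_one \<bullet> x) + 1) *\<^sub>R (x - oct_one) = 0"
    using assms by (auto simp: oct_square oct_cnj_eq algebra_simps)
  also have "\<dots> \<longleftrightarrow> x = oct_one \<or> oct_one \<bullet> x = - 1 / 2"
    by auto
  finally show ?thesis .
qed

text \<open>
  Triality applied twice to the Moufang triple of \<open>s\<close> gives the element that acts by
  \<open>(u, w) \<mapsto> (s u, s\<^sup>* w)\<close>.  It carries \<open>o\<close> to \<open>(s, s\<^sup>*)\<close>, so \<open>(x, y)\<close> is pulled back to
  \<open>(s\<^sup>* x, s y)\<close>, which must be a fixed point of triality.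
\<close>

lemma antipodal_pair_iff:
  assumes "norm s = 1" "norm x = 1" "norm y = 1"
  shows "(x, y) \<in> Fix (Gamma_at triality_group (s, oct_cnj s)) \<longleftrightarrow>
    s \<odot> y = oct_cnj x \<odot> s \<and> (x = s \<or> s \<bullet> x = - 1 / 2)"
proof -
  let ?m = "moufang_triple s"
  let ?g = "triality (triality ?m)"
  have m: "?m \<in> carrier Spin8"
    using assms(1) by (rule moufang_triple_Spin8)
  have g: "?g \<in> carrier Spin8"
    by (simp add: m triality_Spin8)
  have s1: "oct_cnj s \<odot> (s \<odot> z) = z" "s \<odot> (oct_cnj s \<odot> z) = z" for z
    using assms(1) by (simp_all add: cnj_mult_mult mult_cnj_mult)
  have act: "spin_act ?g (u, w) = (s \<odot> u, oct_cnj s \<odot> w)" for u w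
    using m triality_Spin8[OF m]
    by (simp add: moufang_triple_def triality_eq oct_cnj_mult)
  have "(x, y) \<in> Fix (Gamma_at triality_group (s, oct_cnj s)) \<longleftrightarrow>
      spin_act ?g (oct_cnj s \<odot> x, s \<odot> y) \<in> Fix (Gamma_at triality_group (spin_act ?g base_pt))"
    by (simp add: act s1 base_pt_def)
  also have "\<dots> \<longleftrightarrow> triality_transf (oct_cnj s \<odot> x, s \<odot> y) = (oct_cnj s \<odot> x, s \<odot> y)"
    using assms by (intro Fix_Gamma_at_iff[OF g]) (simp add: norm_oct_mult)
  also have "\<dots> \<longleftrightarrow> s \<odot> y = oct_cnj x \<odot> s \<and> (oct_cnj s \<odot> x = oct_one \<or> oct_one \<bullet> (oct_cnj s \<odot> x) = - 1 / 2)"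
    using assms by (subst triality_transf_fixed_iff) (simp_all add: norm_oct_mult oct_cnj_mult)
  also have "oct_cnj s \<odot> x = oct_one \<longleftrightarrow> x = s"
    using s1(1)[of oct_one] s1(2)[of x] by auto
  also have "oct_one \<bullet> (oct_cnj s \<odot> x) = s \<bullet> x"
    using inner_oct_mult_left[of s oct_one x] by simp
  finally show ?thesis .
qed

lemma mem_sphere6: "v \<in> sphere6 \<longleftrightarrow> norm v = 1 \<and> oct_one \<bullet> v = 0"
  by (auto simp: sphere6_def oct_Im_def orthogonal_comp_def orthogonal_def span_singleton)

lemma inner_cube_root:
  assumes "v \<in> sphere6" "w \<in> sphere6"
  shows "cube_root v \<bullet> cube_root w = 1 / 4 + 3 / 4 * (v \<bullet> w)"
proof -
  have "oct_one \<bullet> oct_one = 1" "v \<bullet> oct_one = 0" "oct_one \<bullet> w = 0"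
    using assms norm_oct_one unfolding norm_eq_1 by (auto simp: mem_sphere6 inner_commute)
  then show ?thesis
    by (simp add: cube_root_def inner_simps)
qed

lemma norm_cube_root [simp]:
  assumes "v \<in> sphere6"
  shows "norm (cube_root v) = 1"
proof -
  have "v \<bullet> v = 1"
    using assms by (simp add: mem_sphere6 norm_eq_1)
  then show ?thesis
    using inner_cube_root[OF assms assms] by (simp add: norm_eq_1)
qed

lemma inner_one_cube_root:
  assumes "v \<in> sphere6"
  shows "oct_one \<bullet> cube_root v = - 1 / 2"
  using assms norm_oct_one unfolding norm_eq_1 by (simp add: mem_sphere6 cube_root_def inner_simps)

lemma cnj_cube_root:
  assumes "v \<in> sphere6"
  shows "oct_cnj (cube_root v) = cube_root (- v)"
  using assms
  by (simp add: mem_sphere6 cube_root_def oct_cnj_linear_simps oct_cnj_eq[of v])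

lemma cube_root_square:
  assumes "v \<in> sphere6"
  shows "cube_root v \<odot> cube_root v = oct_cnj (cube_root v)"
  using assms by (simp add: oct_square oct_cnj_eq inner_one_cube_root)

lemma unit_cube_root_cases:
  assumes "norm x = 1" "oct_one \<bullet> x = - 1 / 2"
  obtains v where "v \<in> sphere6" "x = cube_root v"
proof -
  let ?v = "(1 / sqrt 3) *\<^sub>R (oct_one + 2 *\<^sub>R x)"
  have one: "oct_one \<bullet> oct_one = 1" "x \<bullet> x = 1" "x \<bullet> oct_one = - 1 / 2"
    using assms norm_oct_one unfolding norm_eq_1 by (simp_all add: inner_commute)
  have "?v \<bullet> ?v = 1" "oct_one \<bullet> ?v = 0"
    using one assms(2) by (simp_all add: inner_simps field_simps)
  then have "?v \<in> sphere6"
    unfolding mem_sphere6 norm_eq_1 by blast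
  moreover have "x = cube_root ?v"
    by (simp add: cube_root_def)
  ultimately show ?thesis by (rule that)
qed

lemma antipodal_to_base_pt:
  assumes "norm x = 1" "norm y = 1" "(x, y) \<in> Fix (Gamma_at triality_group base_pt)"
  shows "(x, y) = base_pt \<or> (\<exists>v\<in>sphere6. (x, y) = (cube_root v, oct_cnj (cube_root v)))"
proof -
  have "y = oct_cnj x" "x = oct_one \<or> oct_one \<bullet> x = - 1 / 2"
    using antipodal_pair_iff[of oct_one x y] assms by (auto simp: base_pt_def)
  then show ?thesis
    using unit_cube_root_cases[OF assms(1)] by (auto simp: base_pt_def)
qed

lemma antipodal_cube_roots:
  assumes "v \<in> sphere6" "w \<in> sphere6"
    and "(cube_root w, oct_cnj (cube_root w))
      \<in> Fix (Gamma_at triality_group (cube_root v, oct_cnj (cube_root v)))"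
  shows "w = v \<or> w = - v"
proof -
  have vw: "norm v = 1" "norm w = 1"
    using assms by (auto simp: mem_sphere6)
  have "cube_root w = cube_root v \<or> cube_root v \<bullet> cube_root w = - 1 / 2"
    using assms antipodal_pair_iff[of "cube_root v" "cube_root w" "oct_cnj (cube_root w)"] by simp
  then show ?thesis
  proof
    assume "cube_root w = cube_root v"
    then show ?thesis by (simp add: cube_root_def)
  next
    assume "cube_root v \<bullet> cube_root w = - 1 / 2"
    then have "v \<bullet> w = - 1"
      using inner_cube_root[OF assms(1,2)] by simp
    then have "(v + w) \<bullet> (v + w) = 0"
      using vw unfolding norm_eq_1 by (simp add: inner_simps inner_commute)
    then show ?thesis
      by (simp add: add_eq_0_iff)
  qed
qed

lemma uminus_sphere6: "v \<in> sphere6 \<Longrightarrow> - v \<in> sphere6"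
  by (simp add: mem_sphere6)

text \<open>
  In this form the three points look alike: each of the last two is a cube root of unity with its
  conjugate.
\<close>

lemma cube_root_set_eq:
  assumes "v \<in> sphere6"
  shows "cube_root_set v = {base_pt, (cube_root v, oct_cnj (cube_root v)),
    (cube_root (- v), oct_cnj (cube_root (- v)))}"
  using assms by (simp add: cube_root_set_def base_pt_def flip: cnj_cube_root)

lemma antipodal_cube_root_set:
  assumes "v \<in> sphere6"
  shows "antipodal_set triality_group (cube_root_set v)"
proof -
  let ?s = "cube_root v"
  have s: "norm ?s = 1" "oct_one \<bullet> ?s = - 1 / 2" "?s \<odot> ?s = oct_cnj ?s"
    "oct_one \<bullet> oct_cnj ?s = - 1 / 2" "oct_cnj ?s \<odot> oct_cnj ?s = ?s" "?s \<bullet> oct_cnj ?s = - 1 / 2"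
    using assms uminus_sphere6[OF assms] inner_cube_root[OF assms uminus_sphere6[OF assms]]
      cube_root_square[OF uminus_sphere6[OF assms]]
    by (simp_all add: inner_one_cube_root cube_root_square cnj_cube_root mem_sphere6 norm_eq_1)
  have inverse: "oct_cnj ?s \<odot> ?s = oct_one" "?s \<odot> oct_cnj ?s = oct_one"
    using s(1) mult_cnj_mult_right[of oct_one ?s] oct_mult_cnj[of ?s] by simp_all
  have image: "cube_root_set v = (\<lambda>a. (a, oct_cnj a)) ` {oct_one, ?s, oct_cnj ?s}"
    by (simp add: cube_root_set_def)
  have "cube_root_set v \<subseteq> S7xS7"
    using s by (simp add: cube_root_set_def)
  moreover have "q \<in> Fix (Gamma_at triality_group p)"
    if pq: "p \<in> cube_root_set v" "q \<in> cube_root_set v" for p q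
  proof -
    obtain a where a: "p = (a, oct_cnj a)" "a \<in> {oct_one, ?s, oct_cnj ?s}"
      using pq(1) unfolding image by blast
    obtain b where b: "q = (b, oct_cnj b)" "b \<in> {oct_one, ?s, oct_cnj ?s}"
      using pq(2) unfolding image by blast
    have "norm a = 1" "norm b = 1"
      using a b s by auto
    then show ?thesis
      unfolding a(1) b(1) using a(2) b(2) s
      by (subst antipodal_pair_iff) (auto simp: inner_commute inverse)
  qed
  ultimately show ?thesis
    unfolding antipodal_set_def by blast
qed

lemma antipodal_set_subset:
  assumes "antipodal_set triality_group P" "base_pt \<in> P" "v \<in> sphere6"
    and "(cube_root v, oct_cnj (cube_root v)) \<in> P"
  shows "P \<subseteq> cube_root_set v"
proof
  fix p assume p: "p \<in> P"
  obtain x y where xy: "p = (x, y)"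
    by (cases p)
  have "p \<in> S7xS7" "p \<in> Fix (Gamma_at triality_group base_pt)"
    and v: "p \<in> Fix (Gamma_at triality_group (cube_root v, oct_cnj (cube_root v)))"
    using assms p unfolding antipodal_set_def by blast+
  then consider "p = base_pt" | w where "w \<in> sphere6" "p = (cube_root w, oct_cnj (cube_root w))"
    using antipodal_to_base_pt[of x y] by (auto simp: xy)
  then show "p \<in> cube_root_set v"
  proof cases
    case 1
    then show ?thesis using assms(3) by (simp add: cube_root_set_eq)
  next
    case 2
    then have "w = v \<or> w = - v"
      using antipodal_cube_roots assms(3) v by blast
    then show ?thesis
      using assms(3) 2 by (auto simp: cube_root_set_eq)
  qed
qed

text \<open>
  Any point of \<open>P\<close> other than \<open>o\<close> determines \<open>v\<close> up to sign; if there is none, any \<open>v\<close> will do.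
\<close>

lemma antipodal_set_subset_cube_root_set:
  assumes "antipodal_set triality_group P" "base_pt \<in> P"
  obtains v where "v \<in> sphere6" "P \<subseteq> cube_root_set v"
proof (cases "P = {base_pt}")
  case True
  have "axis 1 1 \<in> sphere6"
    by (simp add: mem_sphere6 oct_one_def inner_axis_axis)
  then show ?thesis
    using True that by (simp add: cube_root_set_eq)
next
  case False
  then obtain p where p: "p \<in> P" "p \<noteq> base_pt"
    using assms(2) by blast
  obtain x y where xy: "p = (x, y)"
    by (cases p)
  have "p \<in> S7xS7" "p \<in> Fix (Gamma_at triality_group base_pt)"
    using assms p unfolding antipodal_set_def by blast+
  then obtain v where "v \<in> sphere6" "p = (cube_root v, oct_cnj (cube_root v))"
    using antipodal_to_base_pt[of x y] p(2) by (auto simp: xy)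
  then show ?thesis
    using that antipodal_set_subset[OF assms] p(1) by blast
qed


section \<open>Maximal antipodal sets\<close>

theorem theorem5p2:
  shows
    "(\<forall>P. maximal_antipodal_set triality_group P \<and> base_pt \<in> P \<longrightarrow>
        (\<exists>v\<in>sphere6. P = cube_root_set v)) \<and>
     (\<forall>v\<in>sphere6.
        maximal_antipodal_set triality_group (cube_root_set v) \<and> base_pt \<in> cube_root_set v) \<and>
     (\<forall>v\<in>sphere6.
        aut_act outer_invol (oct_one, oct_one) = (oct_one, oct_one) \<and>
        aut_act outer_invol (cube_root v, oct_cnj (cube_root v)) = (oct_cnj (cube_root v), cube_root v) \<and>
        aut_act outer_invol (oct_cnj (cube_root v), cube_root v) = (cube_root v, oct_cnj (cube_root v)))"
proof (intro conjI allI ballI impI)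
  fix P
  assume P: "maximal_antipodal_set triality_group P \<and> base_pt \<in> P"
  then obtain v where "v \<in> sphere6" "P \<subseteq> cube_root_set v"
    using antipodal_set_subset_cube_root_set unfolding maximal_antipodal_set_def by blast
  then show "\<exists>v\<in>sphere6. P = cube_root_set v"
    using P antipodal_cube_root_set unfolding maximal_antipodal_set_def by blast
next
  fix v :: octonion
  assume v: "v \<in> sphere6"
  show base: "base_pt \<in> cube_root_set v"
    using v by (simp add: cube_root_set_eq)
  have "(cube_root v, oct_cnj (cube_root v)) \<in> cube_root_set v"
    by (simp add: cube_root_set_def)
  then have "Q = cube_root_set v" if "antipodal_set triality_group Q" "cube_root_set v \<subseteq> Q" for Q
    using antipodal_set_subset[OF that(1) _ v] that(2) base by blast
  then show "maximal_antipodal_set triality_group (cube_root_set v)"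
    unfolding maximal_antipodal_set_def using antipodal_cube_root_set[OF v] by blast
qed (simp_all add: aut_act_outer_invol)

end
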